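(* For every integer $n\ge 0$, \[ D_{\mathcal{A}}(n) = b(n)\,e_{\mathcal{A}} + g(n)\quad\text{in } \mathcal{A}, \] where $(b(n))_{n\ge0}$ is the sequence of Bell numbers, defined by $b(0)=1$ and $b(n+1)=\sum_{k=0}^{n}\binom{n}{k}b(k)$ for $n\ge 0$, and $(g(n))_{n\ge 0}$ is the integer sequence defined by $g(0)=0$, $g(1)=1$ and $g(n+1)=\sum_{k=0}^{n}\binom{n}{k}g(k)$ for $n\ge 1$.
   Context: $\mathcal{A}\coloneqq\big(\prod_{p\text{ prime}}\mathbb{Z}/p\mathbb{Z}\big)/\big(\bigoplus_{p\text{ prime}}\mathbb{Z}/p\mathbb{Z}\big)$. Rational numbers are embedded diagonally, making $\mathcal{A}$ a $\mathbb{Q}$-algebra; for the finitely many primes $p$ dividing the denominator of a rational number, its $p$-component is assigned arbitrarily (this does not affect the element of $\mathcal{A}$). Define $D_{\mathcal{A}}(n)\coloneqq\big(\sum_{k=0}^{p-1}\frac{k^n}{k!}\bmod p\big)_p\in\mathcal{A}$ (with the convention $0^0=1$), and $e_{\mathcal{A}}\coloneqq D_{\mathcal{A}}(0)$. *)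

theory Defs
  imports "HOL-Number_Theory.Residues" "HOL-Algebra.QuotRing"
begin

definition product_ring :: "'i set \<Rightarrow> ('i \<Rightarrow> ('a, 'm) ring_scheme) \<Rightarrow> ('i \<Rightarrow> 'a) ring" where
  "product_ring I R =
    \<lparr>carrier = (\<Pi>\<^sub>E i\<in>I. carrier (R i)),
     monoid.mult = (\<lambda>x y. \<lambda>i\<in>I. x i \<otimes>\<^bsub>R i\<^esub> y i),
     one = (\<lambda>i\<in>I. \<one>\<^bsub>R i\<^esub>),
     zero = (\<lambda>i\<in>I. \<zero>\<^bsub>R i\<^esub>),
     add = (\<lambda>x y. \<lambda>i\<in>I. x i \<oplus>\<^bsub>R i\<^esub> y i)\<rparr>"

definition direct_sum_ideal :: "'i set \<Rightarrow> ('i \<Rightarrow> ('a, 'm) ring_scheme) \<Rightarrow> ('i \<Rightarrow> 'a) set" where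
  "direct_sum_ideal I R =
    {x \<in> carrier (product_ring I R). finite {i \<in> I. x i \<noteq> \<zero>\<^bsub>R i\<^esub>}}"

abbreviation primes :: "nat set" where
  "primes \<equiv> {p. prime p}"

abbreviation Z_mod :: "nat \<Rightarrow> int ring" where
  "Z_mod p \<equiv> residue_ring (int p)"

definition prod_Z_mod :: "(nat \<Rightarrow> int) ring" where
  "prod_Z_mod = product_ring primes Z_mod"

definition sum_Z_mod :: "(nat \<Rightarrow> int) set" where
  "sum_Z_mod = direct_sum_ideal primes Z_mod"

definition ring_A :: "(nat \<Rightarrow> int) set ring" where
  "ring_A = prod_Z_mod Quot sum_Z_mod"

text \<open>The element \<open>(x\<^sub>p)\<^sub>p\<close> of \<open>\<A>\<close>; values of \<open>x\<close> at non-primes are discarded.\<close>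
definition class_A :: "(nat \<Rightarrow> int) \<Rightarrow> (nat \<Rightarrow> int) set" where
  "class_A x = sum_Z_mod +>\<^bsub>prod_Z_mod\<^esub> restrict x primes"

text \<open>The residue of a rational number modulo a prime \<open>p\<close>. The value \<open>0\<close> for \<open>p\<close> dividing
  the reduced denominator is the arbitrary choice in the diagonal embedding.\<close>
definition rat_mod :: "rat \<Rightarrow> nat \<Rightarrow> int" where
  "rat_mod q p = (let (a, b) = quotient_of q in
     if int p dvd b then 0
     else (a mod int p) \<otimes>\<^bsub>Z_mod p\<^esub> inv\<^bsub>Z_mod p\<^esub> (b mod int p))"

definition rat_A :: "rat \<Rightarrow> (nat \<Rightarrow> int) set" where
  "rat_A q = class_A (rat_mod q)"

text \<open>The summands have denominators prime to \<open>p\<close>, because \<open>k < p\<close>; hence the exceptional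
  case of \<^const>\<open>rat_mod\<close> does not occur here (see \<open>D_A_sum_p_integral\<close> below).
  Note that \<open>0 ^ 0 = 1\<close>.\<close>
definition D_A :: "nat \<Rightarrow> (nat \<Rightarrow> int) set" where
  "D_A n = class_A (\<lambda>p. rat_mod (\<Sum>k = 0..p - 1. of_nat (k ^ n) / of_nat (fact k)) p)"

definition e_A :: "(nat \<Rightarrow> int) set" where
  "e_A = D_A 0"

fun bell :: "nat \<Rightarrow> nat" where
  "bell 0 = 1"
| "bell (Suc n) = (\<Sum>k = 0..n. (n choose k) * bell k)"

fun g_seq :: "nat \<Rightarrow> int" where
  "g_seq 0 = 0"
| "g_seq (Suc 0) = 1"
| "g_seq (Suc (Suc n)) = (\<Sum>k = 0..Suc n. int (Suc n choose k) * g_seq k)"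


section \<open>Well-definedness\<close>

lemma cring_product_ring:
  assumes R: "\<And>i. i \<in> I \<Longrightarrow> cring (R i)"
  shows "cring (product_ring I R)"
proof -
  note S = cring.cring_simprules[OF R]
  show ?thesis
  proof (intro cringI abelian_groupI comm_monoidI)
    fix x assume x: "x \<in> carrier (product_ring I R)"
    show "\<exists>y\<in>carrier (product_ring I R). y \<oplus>\<^bsub>product_ring I R\<^esub> x = \<zero>\<^bsub>product_ring I R\<^esub>"
      by (rule bexI[of _ "\<lambda>i\<in>I. \<ominus>\<^bsub>R i\<^esub> x i"])
        (use x in \<open>auto simp: product_ring_def PiE_iff S intro!: restrict_ext\<close>)
  qed (auto simp: product_ring_def PiE_iff extensional_def fun_eq_iff S
        monoid.r_one[OF ring.is_monoid[OF cring.axioms(1)[OF R]]])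
qed

lemma ideal_direct_sum:
  assumes R: "\<And>i. i \<in> I \<Longrightarrow> cring (R i)"
  shows "ideal (direct_sum_ideal I R) (product_ring I R)"
proof -
  note S = cring.cring_simprules[OF R]
  interpret P: cring "product_ring I R" by (rule cring_product_ring) (rule R)
  have minus: "\<ominus>\<^bsub>product_ring I R\<^esub> x = (\<lambda>i\<in>I. \<ominus>\<^bsub>R i\<^esub> x i)"
    if "x \<in> carrier (product_ring I R)" for x
    by (rule P.minus_equality)
      (use that in \<open>auto simp: product_ring_def PiE_iff S intro!: restrict_ext\<close>)
  show ?thesis
  proof (rule idealI)
    show "ring (product_ring I R)" by unfold_locales
    show "subgroup (direct_sum_ideal I R) (add_monoid (product_ring I R))"
    proof (rule P.add.subgroupI)
      show "direct_sum_ideal I R \<noteq> {}"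
        by (rule ex_in_conv[THEN iffD1], rule exI[of _ "\<zero>\<^bsub>product_ring I R\<^esub>"])
          (auto simp: direct_sum_ideal_def product_ring_def S intro: finite_subset[of _ "{}"])
    next
      fix x assume x: "x \<in> direct_sum_ideal I R"
      have "{i \<in> I. (\<ominus>\<^bsub>product_ring I R\<^esub> x) i \<noteq> \<zero>\<^bsub>R i\<^esub>} \<subseteq> {i \<in> I. x i \<noteq> \<zero>\<^bsub>R i\<^esub>}"
        using x by (auto simp: direct_sum_ideal_def minus S ring.minus_zero[OF cring.axioms(1)[OF R]])
      with x show "\<ominus>\<^bsub>product_ring I R\<^esub> x \<in> direct_sum_ideal I R"
        by (auto simp: direct_sum_ideal_def intro: finite_subset)
    next
      fix x y assume x: "x \<in> direct_sum_ideal I R" and y: "y \<in> direct_sum_ideal I R"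
      have "{i \<in> I. (x \<oplus>\<^bsub>product_ring I R\<^esub> y) i \<noteq> \<zero>\<^bsub>R i\<^esub>}
          \<subseteq> {i \<in> I. x i \<noteq> \<zero>\<^bsub>R i\<^esub>} \<union> {i \<in> I. y i \<noteq> \<zero>\<^bsub>R i\<^esub>}"
        by (auto simp: product_ring_def S)
      with x y show "x \<oplus>\<^bsub>product_ring I R\<^esub> y \<in> direct_sum_ideal I R"
        by (auto simp: direct_sum_ideal_def intro: finite_subset)
    qed (auto simp: direct_sum_ideal_def)
  next
    fix a x assume a: "a \<in> direct_sum_ideal I R" and x: "x \<in> carrier (product_ring I R)"
    have "{i \<in> I. (x \<otimes>\<^bsub>product_ring I R\<^esub> a) i \<noteq> \<zero>\<^bsub>R i\<^esub>} \<subseteq> {i \<in> I. a i \<noteq> \<zero>\<^bsub>R i\<^esub>}"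
      using x by (auto simp: product_ring_def PiE_iff S)
    with a x show *: "x \<otimes>\<^bsub>product_ring I R\<^esub> a \<in> direct_sum_ideal I R"
      by (auto simp: direct_sum_ideal_def intro: finite_subset)
    show "a \<otimes>\<^bsub>product_ring I R\<^esub> x \<in> direct_sum_ideal I R"
      using * a x P.m_comm[of a x] by (simp add: direct_sum_ideal_def)
  qed
qed

lemma cring_Z_mod: "prime p \<Longrightarrow> cring (Z_mod p)"
  by (rule residues.cring, unfold_locales) (use prime_gt_1_nat in auto)

lemma ideal_sum_Z_mod: "ideal sum_Z_mod prod_Z_mod"
  unfolding sum_Z_mod_def prod_Z_mod_def
  by (rule ideal_direct_sum) (simp add: cring_Z_mod)

lemma cring_ring_A: "cring ring_A"
  unfolding ring_A_def
  by (rule ideal.quotient_is_cring[OF ideal_sum_Z_mod], unfold prod_Z_mod_def,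
      rule cring_product_ring) (simp add: cring_Z_mod)

lemma prime_dvd_denominator:
  fixes p :: nat and a b c d :: int
  assumes "prime p" and "quotient_of q = (a, b)" and "q * of_int d = of_int c"
    and "int p dvd b"
  shows "int p dvd d"
proof -
  have b: "b > 0" and ab: "coprime a b" and q: "q = of_int a / of_int b"
    using assms(2) by (auto simp: quotient_of_denom_pos quotient_of_coprime quotient_of_div)
  have "(of_int (a * d) :: rat) = of_int (c * b)"
    using assms(3) b by (simp add: q field_simps)
  then have "a * d = c * b" by (simp only: of_int_eq_iff)
  then have "b dvd a * d" by simp
  with ab have "b dvd d" by (simp add: coprime_commute coprime_dvd_mult_right_iff)
  with assms(4) show ?thesis by (rule dvd_trans)
qed

lemma D_A_sum_p_integral:
  fixes p n :: nat
  assumes p: "prime p"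
    and q: "quotient_of (\<Sum>k = 0..p - 1. of_nat (k ^ n) / of_nat (fact k)) = (a, b)"
  shows "\<not> int p dvd b"
proof
  assume b: "int p dvd b"
  have t: "(of_nat (k ^ n) / of_nat (fact k) * of_int (fact (p - 1)) :: rat)
      = of_int (int (k ^ n) * (fact (p - 1) div fact k))" if "k \<in> {0..p - 1}" for k
  proof -
    from that have "(fact k :: int) dvd fact (p - 1)" by (intro fact_dvd) auto
    then obtain m :: int where "fact (p - 1) = fact k * m" by (rule dvdE)
    then show ?thesis by simp
  qed
  have "(\<Sum>k = 0..p - 1. of_nat (k ^ n) / of_nat (fact k)) * of_int (fact (p - 1))
      = (of_int (\<Sum>k = 0..p - 1. int (k ^ n) * (fact (p - 1) div fact k)) :: rat)"
    unfolding sum_distrib_right of_int_sum by (rule sum.cong) (simp_all only: t)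
  then have "int p dvd fact (p - 1)" by (rule prime_dvd_denominator[OF p q _ b])
  then have "p dvd fact (p - 1)" by (metis of_nat_dvd_iff of_nat_fact)
  with p show False using prime_dvd_fact_iff prime_gt_0_nat by (metis diff_less leD zero_less_one)
qed

text \<open>On rationals that are integral at \<open>p\<close>, \<^const>\<open>rat_mod\<close> is the usual reduction.\<close>
lemma rat_mod_eq_iff:
  fixes p :: nat and c d :: int
  assumes p: "prime p" and q: "q * of_int d = of_int c" and d: "\<not> int p dvd d"
  shows "rat_mod q p = r \<longleftrightarrow> 0 \<le> r \<and> r < int p \<and> [r * d = c] (mod int p)"
proof -
  interpret residues_prime p "Z_mod p" by unfold_locales (rule p)
  obtain a b where ab: "quotient_of q = (a, b)" by force
  have b: "b > 0" and q': "q = of_int a / of_int b"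
    using ab by (auto simp: quotient_of_denom_pos quotient_of_div)
  have pb: "\<not> int p dvd b" using prime_dvd_denominator[OF p ab q] d by blast
  have "(of_int (a * d) :: rat) = of_int (c * b)"
    using q b by (simp add: q' field_simps)
  then have ad: "a * d = c * b" by (simp only: of_int_eq_iff)
  define i where "i = inv\<^bsub>Z_mod p\<^esub> (b mod int p)"
  have "coprime b (int p)" using pb by (simp add: p_coprime_right_int)
  then have u: "b mod int p \<in> Units (Z_mod p)" using m_gt_one by (rule mod_in_res_units[rotated])
  then have "i \<otimes>\<^bsub>Z_mod p\<^esub> (b mod int p) = \<one>\<^bsub>Z_mod p\<^esub>" unfolding i_def by (rule Units_l_inv)
  then have ib: "[i * b = 1] (mod int p)"
    using m_gt_one by (simp add: res_mult_eq res_one_eq cong_def mod_simps)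
  have rm: "rat_mod q p = (a * i) mod int p"
    using pb by (simp add: rat_mod_def ab i_def res_mult_eq mod_simps)
  have "[a * i * d = c * (i * b)] (mod int p)" using arg_cong[OF ad, of "\<lambda>x. x * i"] by (simp only: ac_simps cong_refl)
  also have "[c * (i * b) = c * 1] (mod int p)" by (intro cong_mult ib cong_refl)
  finally have key: "[(a * i) mod int p * d = c] (mod int p)" by (simp add: cong_def mod_simps)
  have cd: "coprime d (int p)" using d by (simp add: p_coprime_right_int)
  show ?thesis
  proof
    assume "0 \<le> r \<and> r < int p \<and> [r * d = c] (mod int p)"
    moreover from this key have "[(a * i) mod int p * d = r * d] (mod int p)"
      by (meson cong_sym cong_trans)
    with cd have "[(a * i) mod int p = r] (mod int p)" by (simp add: cong_mult_rcancel)
    ultimately show "rat_mod q p = r" by (simp add: rm cong_def)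
  qed (use key m_gt_one in \<open>auto simp: rm\<close>)
qed

lemma finite_bad_primes: "d \<noteq> 0 \<Longrightarrow> finite {p \<in> primes. int p dvd d}"
  by (rule finite_subset[of _ "{..nat \<bar>d\<bar>}"]) (auto dest: dvd_imp_le_int)

lemma rat_mod_in_prod: "restrict (rat_mod q) primes \<in> carrier prod_Z_mod"
proof -
  have "rat_mod q p \<in> {0..int p - 1}" if p: "prime p" for p
  proof (cases "int p dvd snd (quotient_of q)")
    case True
    then show ?thesis using prime_gt_0_nat[OF p] by (auto simp: rat_mod_def split: prod.split)
  next
    case False
    have "q * of_int (snd (quotient_of q)) = of_int (fst (quotient_of q))"
      using quotient_of_div[of q "fst (quotient_of q)" "snd (quotient_of q)"]
        quotient_of_denom_pos'[of q] by (simp add: eq_divide_eq)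
    from rat_mod_eq_iff[OF p this False, of "rat_mod q p"] show ?thesis by simp
  qed
  then show ?thesis by (simp add: prod_Z_mod_def product_ring_def residue_ring_def)
qed

text \<open>\<^const>\<open>class_A\<close> depends only on all but finitely many components.\<close>
lemma class_A_eqI:
  assumes x: "restrict x primes \<in> carrier prod_Z_mod" and y: "restrict y primes \<in> carrier prod_Z_mod"
    and fin: "finite {p \<in> primes. x p \<noteq> y p}"
  shows "class_A x = class_A y"
proof -
  interpret ideal sum_Z_mod prod_Z_mod by (rule ideal_sum_Z_mod)
  define z where "z = (\<lambda>p\<in>primes. (x p - y p) mod int p)"
  have "finite {p \<in> primes. z p \<noteq> 0}"
    by (rule finite_subset[OF _ fin]) (auto simp: z_def)
  then have "z \<in> sum_Z_mod"
    by (auto simp: sum_Z_mod_def direct_sum_ideal_def product_ring_def residue_ring_def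
        prime_gt_0_nat z_def)
  moreover have "restrict x primes = z \<oplus>\<^bsub>prod_Z_mod\<^esub> restrict y primes"
    using x by (auto simp: z_def prod_Z_mod_def product_ring_def residue_ring_def PiE_iff
        fun_eq_iff mod_simps)
  ultimately have "restrict x primes \<in> sum_Z_mod +>\<^bsub>prod_Z_mod\<^esub> restrict y primes"
    unfolding a_r_coset_def' by blast
  then show ?thesis unfolding class_A_def using y by (metis a_repr_independence')
qed

lemma class_A_add:
  assumes x: "restrict x primes \<in> carrier prod_Z_mod" and y: "restrict y primes \<in> carrier prod_Z_mod"
  shows "class_A x \<oplus>\<^bsub>ring_A\<^esub> class_A y = class_A (\<lambda>p. (x p + y p) mod int p)"
proof -
  interpret ideal sum_Z_mod prod_Z_mod by (rule ideal_sum_Z_mod)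
  have "restrict x primes \<oplus>\<^bsub>prod_Z_mod\<^esub> restrict y primes = (\<lambda>p\<in>primes. (x p + y p) mod int p)"
    by (auto simp: prod_Z_mod_def product_ring_def residue_ring_def)
  then show ?thesis using a_rcos_sum[OF x y] by (simp add: class_A_def ring_A_def FactRing_def)
qed

lemma class_A_mult:
  assumes x: "restrict x primes \<in> carrier prod_Z_mod" and y: "restrict y primes \<in> carrier prod_Z_mod"
  shows "class_A x \<otimes>\<^bsub>ring_A\<^esub> class_A y = class_A (\<lambda>p. (x p * y p) mod int p)"
proof -
  interpret ideal sum_Z_mod prod_Z_mod by (rule ideal_sum_Z_mod)
  have "restrict x primes \<otimes>\<^bsub>prod_Z_mod\<^esub> restrict y primes = (\<lambda>p\<in>primes. (x p * y p) mod int p)"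
    by (auto simp: prod_Z_mod_def product_ring_def residue_ring_def)
  then show ?thesis using rcoset_mult_add[OF x y] by (simp add: class_A_def ring_A_def FactRing_def)
qed

lemma mod_in_prod: "(\<lambda>p\<in>primes. f p mod int p) \<in> carrier prod_Z_mod"
  by (auto simp: prod_Z_mod_def product_ring_def residue_ring_def prime_gt_0_nat)

text \<open>The diagonal map \<open>\<rat> \<rightarrow> \<A>\<close> is a ring homomorphism.\<close>

lemma rat_A_1: "rat_A 1 = \<one>\<^bsub>ring_A\<^esub>"
proof -
  have "rat_mod 1 p = 1" if "prime p" for p
    using that prime_gt_1_nat[OF that] by (subst rat_mod_eq_iff[where c = 1 and d = 1]) auto
  then have "restrict (rat_mod 1) primes = \<one>\<^bsub>prod_Z_mod\<^esub>"
    by (auto simp: prod_Z_mod_def product_ring_def residue_ring_def)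
  then show ?thesis by (simp add: rat_A_def class_A_def ring_A_def FactRing_def)
qed

lemma rat_A_hom:
  shows rat_A_add: "rat_A (q + r) = rat_A q \<oplus>\<^bsub>ring_A\<^esub> rat_A r"
    and rat_A_mult: "rat_A (q * r) = rat_A q \<otimes>\<^bsub>ring_A\<^esub> rat_A r"
proof -
  obtain a b where q: "q * of_int b = of_int a" and b: "b \<noteq> 0"
    using quotient_of_div[of q] quotient_of_denom_pos[of q]
    by (metis less_irrefl nonzero_eq_divide_eq of_int_eq_0_iff surj_pair)
  obtain c d where r: "r * of_int d = of_int c" and d: "d \<noteq> 0"
    using quotient_of_div[of r] quotient_of_denom_pos[of r]
    by (metis less_irrefl nonzero_eq_divide_eq of_int_eq_0_iff surj_pair)
  have s: "(q + r) * of_int (b * d) = of_int (a * d + c * b)"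
    by (simp flip: q r) (simp add: algebra_simps)
  have m: "(q * r) * of_int (b * d) = of_int (a * c)"
    by (simp flip: q r)
  have fin: "finite {p \<in> primes. int p dvd b * d}" using b d by (intro finite_bad_primes) auto
  have *: "rat_mod (q + r) p = (rat_mod q p + rat_mod r p) mod int p
         \<and> rat_mod (q * r) p = (rat_mod q p * rat_mod r p) mod int p"
    if p: "prime p" and bd: "\<not> int p dvd b * d" for p
  proof -
    have "\<not> int p dvd b" "\<not> int p dvd d" using bd by auto
    then have 1: "[rat_mod q p * b = a] (mod int p)" and 2: "[rat_mod r p * d = c] (mod int p)"
      using rat_mod_eq_iff[OF p q] rat_mod_eq_iff[OF p r] by blast+
    have "[rat_mod q p * b * d + rat_mod r p * d * b = a * d + c * b] (mod int p)"
      by (intro cong_add cong_mult 1 2 cong_refl)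
    then have 3: "[(rat_mod q p + rat_mod r p) mod int p * (b * d) = a * d + c * b] (mod int p)"
      unfolding cong_def mod_mult_left_eq by (simp add: algebra_simps)
    have "[(rat_mod q p * b) * (rat_mod r p * d) = a * c] (mod int p)"
      by (intro cong_mult 1 2)
    then have 4: "[(rat_mod q p * rat_mod r p) mod int p * (b * d) = a * c] (mod int p)"
      unfolding cong_def mod_mult_left_eq by (simp add: algebra_simps)
    show ?thesis
      using 3 4 prime_gt_0_nat[OF p]
      by (simp add: rat_mod_eq_iff[OF p s bd] rat_mod_eq_iff[OF p m bd])
  qed
  show "rat_A (q + r) = rat_A q \<oplus>\<^bsub>ring_A\<^esub> rat_A r"
    unfolding rat_A_def class_A_add[OF rat_mod_in_prod rat_mod_in_prod]
    by (rule class_A_eqI[OF rat_mod_in_prod mod_in_prod finite_subset[OF _ fin]]) (use * in auto)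
  show "rat_A (q * r) = rat_A q \<otimes>\<^bsub>ring_A\<^esub> rat_A r"
    unfolding rat_A_def class_A_mult[OF rat_mod_in_prod rat_mod_in_prod]
    by (rule class_A_eqI[OF rat_mod_in_prod mod_in_prod finite_subset[OF _ fin]]) (use * in auto)
qed

end

(* Let S(n) be the sum of k^n / k! over k < p. Cancelling one factor k and shifting the index gives
   S(n+1) = \<Sum>k\<le>n. C(n,k) S(k) - p^n / (p-1)!, and by Wilson's theorem the last term is 1 mod p
   for n = 0 and vanishes mod p for n > 0. This is the common recurrence of b(n) S(0) + g(n), so the
   identity holds modulo every prime. Multiplying by (p-1)! keeps the computation in the integers. *)
theory Submission
  imports Defs
begin

text \<open>Each division is exact because \<open>k\<close> is at most \<open>m\<close>. For
  \<open>m = p - 1\<close> this is the truncated sum cleared of denominators.\<close>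

definition scaled_sum :: "nat \<Rightarrow> nat \<Rightarrow> int" where
  "scaled_sum m n = (\<Sum>k = 0..m. int (k ^ n) * (fact m div fact k))"

lemma scaled_sum_eq:
  "(\<Sum>k = 0..m. of_nat (k ^ n) / of_nat (fact k)) * of_int (fact m) = (of_int (scaled_sum m n) :: rat)"
proof -
  have "of_nat (k ^ n) / of_nat (fact k) * of_int (fact m)
      = (of_int (int (k ^ n) * (fact m div fact k)) :: rat)" if "k \<in> {0..m}" for k
  proof -
    from that have "(fact k :: int) dvd fact m" by (intro fact_dvd) auto
    then obtain c :: int where "fact m = fact k * c" by (rule dvdE)
    then show ?thesis by simp
  qed
  then show ?thesis
    unfolding scaled_sum_def sum_distrib_right of_int_sum by (intro sum.cong) auto
qed

text \<open>Since \<open>k / fact k = 1 / fact (k - 1)\<close>, shifting the index leaves a sum of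
  \<open>(j + 1) ^ n / fact j\<close> over \<open>j < m\<close>. The power added on the left
  completes it to \<open>j = m\<close>; then the binomial theorem and an exchange of sums
  apply.\<close>

lemma scaled_sum_Suc:
  "scaled_sum m (Suc n) + int (Suc m) ^ n = (\<Sum>k = 0..n. int (n choose k) * scaled_sum m k)"
proof -
  have shift: "int (Suc j ^ Suc n) * (fact m div fact (Suc j)) = int (Suc j) ^ n * (fact m div fact j)"
    if "j < m" for j
  proof -
    from that have "(fact (Suc j) :: int) dvd fact m" by (intro fact_dvd) auto
    then obtain c :: int where c: "fact m = fact (Suc j) * c" by (rule dvdE)
    then have "fact m = fact j * (int (Suc j) * c)" by (simp add: algebra_simps)
    then have "(fact m div fact j :: int) = int (Suc j) * c" by simp
    moreover have "(fact m div fact (Suc j) :: int) = c" by (subst c) simp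
    ultimately show ?thesis by (simp add: algebra_simps)
  qed
  have "scaled_sum m (Suc n) = (\<Sum>k\<in>{0..<Suc m}. int (k ^ Suc n) * (fact m div fact k))"
    by (simp only: scaled_sum_def atLeastLessThanSuc_atLeastAtMost)
  \<comment> \<open>The term \<open>k = 0\<close> vanishes because the exponent \<open>Suc n\<close>
    is positive.\<close>
  also have "\<dots> = (\<Sum>j\<in>{0..<m}. int (Suc j ^ Suc n) * (fact m div fact (Suc j)))"
    by (subst sum.atLeast0_lessThan_Suc_shift)
      (simp add: zero_power del: power_Suc of_nat_Suc fact_Suc)
  also have "\<dots> = (\<Sum>j\<in>{0..<m}. int (Suc j) ^ n * (fact m div fact j))"
    by (intro sum.cong shift) auto
  finally have "scaled_sum m (Suc n) + int (Suc m) ^ n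
      = (\<Sum>j\<in>{0..<Suc m}. int (Suc j) ^ n * (fact m div fact j))"
    by simp
  also have "\<dots> = (\<Sum>j = 0..m. \<Sum>k = 0..n. int (n choose k) * (int (j ^ k) * (fact m div fact j)))"
  proof (rule sum.cong)
    fix j
    have "int (Suc j) ^ n = (\<Sum>k = 0..n. int (n choose k) * int j ^ k)"
      using binomial_ring[of "int j" 1 n] by (simp add: add.commute atMost_atLeast0)
    then show "int (Suc j) ^ n * (fact m div fact j)
        = (\<Sum>k = 0..n. int (n choose k) * (int (j ^ k) * (fact m div fact j)))"
      by (simp add: sum_distrib_right mult.assoc)
  qed auto
  also have "\<dots> = (\<Sum>k = 0..n. int (n choose k) * scaled_sum m k)"
    unfolding scaled_sum_def sum_distrib_left by (rule sum.swap)
  finally show ?thesis .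
qed

text \<open>The sum is zero at \<open>n = 0\<close>, so the correction there supplies the initial
  value 1 and a single recurrence covers all \<open>n\<close>.\<close>

lemma g_seq_Suc:
  "g_seq (Suc n) = (\<Sum>k = 0..n. int (n choose k) * g_seq k) + (if n = 0 then 1 else 0)"
  by (cases n) simp_all

lemma scaled_sum_cong:
  assumes p: "prime p"
  shows "[scaled_sum (p - 1) n
    = int (bell n) * scaled_sum (p - 1) 0 + g_seq n * fact (p - 1)] (mod int p)"
proof (induction n rule: less_induct)
  case (less n)
  define F :: int where "F = fact (p - 1)"
  define T where "T = scaled_sum (p - 1)"
  show ?case
  proof (cases n)
    case 0
    then show ?thesis by simp
  next
    case (Suc m)
    interpret residues_prime p "Z_mod p" by unfold_locales (rule p)
    have "[F = - 1] (mod int p)" unfolding F_def by (rule wilson_theorem) (rule p)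
    \<comment> \<open>For \<open>m = 0\<close> both sides are -1 by Wilson; for \<open>m > 0\<close>
      both vanish modulo \<open>p\<close>. This matches the boundary term with the correction in
      \<open>g_seq_Suc\<close>.\<close>
    then have F: "[- (int p ^ m) = (if m = 0 then 1 else 0) * F] (mod int p)"
      by (cases m) (auto simp: cong_sym_eq cong_iff_dvd_diff)
    have "T (Suc m) = (\<Sum>k = 0..m. int (m choose k) * T k) + - (int p ^ m)"
      using scaled_sum_Suc[of "p - 1" m] prime_gt_0_nat[OF p] by (simp add: T_def)
    also have "[\<dots> = (\<Sum>k = 0..m. int (m choose k) * (int (bell k) * T 0 + g_seq k * F))
        + (if m = 0 then 1 else 0) * F] (mod int p)"
      by (intro cong_add cong_sum cong_mult cong_refl F)
        (use less.IH Suc in \<open>auto simp: T_def F_def\<close>)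
    also have "(\<Sum>k = 0..m. int (m choose k) * (int (bell k) * T 0 + g_seq k * F))
        + (if m = 0 then 1 else 0) * F = int (bell (Suc m)) * T 0 + g_seq (Suc m) * F"
      unfolding g_seq_Suc
      by (simp add: sum.distrib sum_distrib_right sum_distrib_left algebra_simps)
    finally show ?thesis by (simp only: T_def F_def Suc)
  qed
qed

lemma rat_mod_of_int: "prime p \<Longrightarrow> rat_mod (of_int c) p = c mod int p"
  by (subst rat_mod_eq_iff[where c = c and d = 1]) (auto simp: prime_gt_0_nat cong_def)

text \<open>Here the rational may vary with \<open>p\<close>, as the truncated sums do; membership
  is still checked one component at a time.\<close>

lemma rat_mod_diagonal_in_prod: "(\<lambda>p\<in>primes. rat_mod (q p) p) \<in> carrier prod_Z_mod"
  using rat_mod_in_prod by (auto simp: prod_Z_mod_def product_ring_def PiE_iff)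

theorem theorem1p1:
  fixes n :: nat
  shows "D_A n =
    rat_A (of_nat (bell n)) \<otimes>\<^bsub>ring_A\<^esub> e_A \<oplus>\<^bsub>ring_A\<^esub> rat_A (of_int (g_seq n))"
proof -
  define S :: "nat \<Rightarrow> nat \<Rightarrow> rat"
    where "S n p = (\<Sum>k = 0..p - 1. of_nat (k ^ n) / of_nat (fact k))" for n p
  have D: "D_A n = class_A (\<lambda>p. rat_mod (S n p) p)" for n
    unfolding D_A_def S_def ..
  have *: "rat_mod (S n p) p = ((rat_mod (of_nat (bell n)) p * rat_mod (S 0 p) p) mod int p
      + rat_mod (of_int (g_seq n)) p) mod int p" if p: "prime p" for p
  proof -
    define F :: int where "F = fact (p - 1)"
    have F: "\<not> int p dvd F"
      using p prime_gt_0_nat[OF p]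
      by (metis F_def diff_less leD of_nat_dvd_iff of_nat_fact prime_dvd_fact_iff zero_less_one)
    have S: "S n p * of_int F = of_int (scaled_sum (p - 1) n)" for n
      unfolding S_def F_def by (rule scaled_sum_eq)
    have "[rat_mod (S 0 p) p * F = scaled_sum (p - 1) 0] (mod int p)"
      using rat_mod_eq_iff[OF p S F] by blast
    then have "[int (bell n) * (rat_mod (S 0 p) p * F) + g_seq n * F
        = int (bell n) * scaled_sum (p - 1) 0 + g_seq n * F] (mod int p)"
      by (intro cong_add cong_mult cong_refl)
    also have "[int (bell n) * scaled_sum (p - 1) 0 + g_seq n * F = scaled_sum (p - 1) n] (mod int p)"
      unfolding F_def by (rule cong_sym[OF scaled_sum_cong[OF p]])
    finally have "[(int (bell n) * rat_mod (S 0 p) p + g_seq n) * F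
        = scaled_sum (p - 1) n] (mod int p)"
      by (simp add: algebra_simps)
    \<comment> \<open>As \<open>F\<close> is a unit modulo \<open>p\<close>, the residue of
      \<open>S n p\<close> is the only reduced \<open>r\<close> with \<open>r * F\<close> congruent
      to the scaled sum.\<close>
    then have "rat_mod (S n p) p = (int (bell n) * rat_mod (S 0 p) p + g_seq n) mod int p"
      using prime_gt_0_nat[OF p] by (subst rat_mod_eq_iff[OF p S F]) (simp add: cong_def mod_simps)
    then show ?thesis
      using rat_mod_of_int[OF p, of "int (bell n)"] rat_mod_of_int[OF p, of "g_seq n"]
      by (simp add: mod_simps)
  qed
  show ?thesis
    unfolding e_A_def D rat_A_def class_A_mult[OF rat_mod_in_prod rat_mod_diagonal_in_prod]
      class_A_add[OF mod_in_prod rat_mod_in_prod]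
    \<comment> \<open>The components agree at every prime, so the exceptional set is empty.\<close>
    by (rule class_A_eqI[OF rat_mod_diagonal_in_prod mod_in_prod finite_subset[of _ "{}"]])
      (use * in auto)
qed

end
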